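(* Let $(S,T,\alpha,\beta)$ be a matched product system of weak braces. Then $S\times T$ with respect to the operations $$(a,u)+(b,v):=(a+b,\ u+v),$$ $$(a,u)\circ(b,v):=\left(\alpha_u\left(\alpha_u^{-1}(a)\circ b\right),\ \beta_a\left(\beta_a^{-1}(u)\circ v\right)\right),$$ for all $(a,u),(b,v)\in S\times T$, is a weak brace.
   Context: A semigroup is inverse if each element $a$ has a unique inverse, i.e. a unique $x$ with $axa=a$ and $xax=x$. A weak (left) brace is a non-empty set $S$ with two binary operations $+$ and $\circ$ such that $(S,+)$ and $(S,\circ)$ are both inverse semigroups (not necessarily commutative) and, for all $a,b,c\in S$, $a\circ(b+c)=a\circ b-a+a\circ c$ and $a\circ a^-=-a+a$, where $-a$ is the inverse of $a$ in $(S,+)$, $a^-$ is the inverse of $a$ in $(S,\circ)$, and $\circ$ has higher precedence than $+$. Matched product system: let $S$ and $T$ be weak braces, let $\alpha:u\mapsto\alpha_u$ be a homomorphism of inverse semigroups from $(T,\circ)$ into the automorphism group of $(S,+)$, and let $\beta:a\mapsto\beta_a$ be a homomorphism of inverse semigroups from $(S,\circ)$ into the automorphism group of $(T,+)$. Write $\alpha_u^{-1}=(\alpha_u)^{-1}$ and $\beta_a^{-1}=(\beta_a)^{-1}$. Then $(S,T,\alpha,\beta)$ is a matched product system of weak braces if, for all $a,b\in S$ and $u,v\in T$, $$\alpha_u\left(\alpha_u^{-1}(a)\circ b\right)=a\circ\alpha_{\beta_a^{-1}(u)}(b),\qquad \beta_a\left(\beta_a^{-1}(u)\circ v\right)=u\circ\beta_{\alpha_u^{-1}(a)}(v),$$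 and the following implication holds: if $\alpha_u\left(\alpha_u^{-1}(a)\circ a\right)=a$ and $\beta_a\left(\beta_a^{-1}(u)\circ u\right)=u$, then $\alpha_u(a)=a$ and $\beta_a(u)=u$. *)

theory Defs
  imports "HOL-Algebra.Bij"
begin

locale inverse_semigroup =
  fixes S :: "'a set" and f :: "'a \<Rightarrow> 'a \<Rightarrow> 'a" (infixl "\<cdot>" 70)
  assumes closed: "\<And>a b. a \<in> S \<Longrightarrow> b \<in> S \<Longrightarrow> a \<cdot> b \<in> S"
    and assoc: "\<And>a b c. a \<in> S \<Longrightarrow> b \<in> S \<Longrightarrow> c \<in> S \<Longrightarrow> (a \<cdot> b) \<cdot> c = a \<cdot> (b \<cdot> c)"
    and ex1_inverse: "\<And>a. a \<in> S \<Longrightarrow> \<exists>!x. x \<in> S \<and> a \<cdot> x \<cdot> a = a \<and> x \<cdot> a \<cdot> x = x"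
begin

definition inverse_of :: "'a \<Rightarrow> 'a" where
  "inverse_of a = (THE x. x \<in> S \<and> a \<cdot> x \<cdot> a = a \<and> x \<cdot> a \<cdot> x = x)"

end

locale weak_brace =
  plus: inverse_semigroup S plus + circ: inverse_semigroup S circ
  for S :: "'a set"
    and plus :: "'a \<Rightarrow> 'a \<Rightarrow> 'a" (infixl "\<^bold>+" 65)
    and circ :: "'a \<Rightarrow> 'a \<Rightarrow> 'a" (infixl "\<^bold>\<circ>" 70) +
  assumes nonempty: "S \<noteq> {}"
    and distrib: "\<And>a b c. a \<in> S \<Longrightarrow> b \<in> S \<Longrightarrow> c \<in> S \<Longrightarrow>
      a \<^bold>\<circ> (b \<^bold>+ c) = a \<^bold>\<circ> b \<^bold>+ plus.inverse_of a \<^bold>+ a \<^bold>\<circ> c"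
    and circ_inverse: "\<And>a. a \<in> S \<Longrightarrow> a \<^bold>\<circ> circ.inverse_of a = plus.inverse_of a \<^bold>+ a"

text \<open>
  The library's \<^const>\<open>hom\<close> and \<^const>\<open>AutoGroup\<close> take monoid records, but only look at the
  carrier and the multiplication of their arguments; the unit of a semigroup record
  is therefore irrelevant and left unspecified.
\<close>

definition semigroup_record :: "'a set \<Rightarrow> ('a \<Rightarrow> 'a \<Rightarrow> 'a) \<Rightarrow> 'a monoid" where
  "semigroup_record S f = \<lparr>carrier = S, mult = f, one = undefined\<rparr>"

text \<open>
  A homomorphism of inverse semigroups is a homomorphism of semigroups (inverses are then
  preserved automatically). The members of \<^const>\<open>AutoGroup\<close> are extensional functions, so
  the inverse of an automorphism is only ever applied to elements of the carrier.
\<close>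

locale matched_product_system =
  S: weak_brace S plusS circS + T: weak_brace T plusT circT
  for S :: "'a set"
    and plusS :: "'a \<Rightarrow> 'a \<Rightarrow> 'a" (infixl "+\<^sub>S" 65)
    and circS :: "'a \<Rightarrow> 'a \<Rightarrow> 'a" (infixl "\<circ>\<^sub>S" 70)
    and T :: "'b set"
    and plusT :: "'b \<Rightarrow> 'b \<Rightarrow> 'b" (infixl "+\<^sub>T" 65)
    and circT :: "'b \<Rightarrow> 'b \<Rightarrow> 'b" (infixl "\<circ>\<^sub>T" 70) +
  fixes \<alpha> :: "'b \<Rightarrow> 'a \<Rightarrow> 'a" and \<beta> :: "'a \<Rightarrow> 'b \<Rightarrow> 'b"
  assumes alpha_hom: "\<alpha> \<in> hom (semigroup_record T circT) (AutoGroup (semigroup_record S plusS))"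
    and beta_hom: "\<beta> \<in> hom (semigroup_record S circS) (AutoGroup (semigroup_record T plusT))"
    and alpha_circ: "\<And>a b u. a \<in> S \<Longrightarrow> b \<in> S \<Longrightarrow> u \<in> T \<Longrightarrow>
      \<alpha> u (inv_into S (\<alpha> u) a \<circ>\<^sub>S b) = a \<circ>\<^sub>S \<alpha> (inv_into T (\<beta> a) u) b"
    and beta_circ: "\<And>a u v. a \<in> S \<Longrightarrow> u \<in> T \<Longrightarrow> v \<in> T \<Longrightarrow>
      \<beta> a (inv_into T (\<beta> a) u \<circ>\<^sub>T v) = u \<circ>\<^sub>T \<beta> (inv_into S (\<alpha> u) a) v"
    and fixed: "\<And>a u. a \<in> S \<Longrightarrow> u \<in> T \<Longrightarrow>
      \<alpha> u (inv_into S (\<alpha> u) a \<circ>\<^sub>S a) = a \<Longrightarrow> \<beta> a (inv_into T (\<beta> a) u \<circ>\<^sub>T u) = u \<Longrightarrow>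
      \<alpha> u a = a \<and> \<beta> a u = u"

end

theory Submission imports Defs begin

text \<open>
  The hypotheses are symmetric under exchanging \<open>(S, \<alpha>)\<close> with \<open>(T, \<beta>)\<close>, so associativity and
  the distributive law only have to be checked in the first component. Write
  \<open>a' = \<alpha>\<^sub>u\<^sup>-\<^sup>1(a)\<close> and \<open>u' = \<beta>\<^sub>a\<^sup>-\<^sup>1(u)\<close>.

  The product has two equivalent forms, \<open>\<alpha>\<^sub>u(a' \<circ> b)\<close> and \<open>a \<circ> \<alpha>\<^sub>u\<^sub>'(b)\<close>; the compatibility
  conditions say exactly that they agree. The first form is an additive automorphism applied to a
  product in \<open>S\<close>, and this carries the distributive law over from \<open>S\<close>. The second form makes
  \<open>y = (\<alpha>\<^sub>u\<^sub>'\<^sup>-\<^sup>1(a\<^sup>-), \<beta>\<^sub>a\<^sub>'\<^sup>-\<^sup>1(u\<^sup>-))\<close> a right inverse of \<open>x = (a, u)\<close>, in the sense that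
  \<open>x \<circ> y = (a \<circ> a\<^sup>-, u \<circ> u\<^sup>-)\<close>. Playing the two forms against each other gives associativity.

  A homomorphism into a group sends idempotents to the identity, so multiplication by a pair
  of idempotents from the left is computed componentwise. Hence \<open>x \<circ> y \<circ> x = x\<close>, and
  \<open>y \<circ> x \<circ> y\<close> is an inverse \<open>x\<^sup>-\<close> of \<open>x\<close> with \<open>x \<circ> x\<^sup>- = x \<circ> y\<close>, which the brace axioms of the two factors identify with
  \<open>-x + x\<close>. What remains is uniqueness of inverses, which for a regular semigroup amounts to
  idempotents commuting. The last condition on a matched product system is what is needed
  here: it forces an idempotent of the product to be a pair of idempotents, and such pairs commute
  because idempotents commute in each factor.
\<close>

section \<open>Inverse semigroups and commuting idempotents\<close>

context inverse_semigroup
begin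

lemma inverse_of_eqI:
  assumes "a \<in> S" "x \<in> S" "a \<cdot> x \<cdot> a = a" "x \<cdot> a \<cdot> x = x"
  shows "inverse_of a = x"
  unfolding inverse_of_def using assms ex1_inverse[OF assms(1)] by (intro the1_equality) auto

lemma
  assumes "a \<in> S"
  shows inverse_of_closed: "inverse_of a \<in> S"
    and mult_inverse_mult: "a \<cdot> inverse_of a \<cdot> a = a"
    and inverse_mult_inverse: "inverse_of a \<cdot> a \<cdot> inverse_of a = inverse_of a"
  using theI'[OF ex1_inverse[OF assms]] unfolding inverse_of_def[symmetric] by blast+

lemma mult_inverse_idem:
  assumes "a \<in> S"
  shows "(a \<cdot> inverse_of a) \<cdot> (a \<cdot> inverse_of a) = a \<cdot> inverse_of a"
  using assms by (metis assoc closed inverse_of_closed mult_inverse_mult)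

text \<open>
  The inverse \<open>x\<close> of \<open>e \<cdot> g\<close> must coincide with the inverse \<open>g \<cdot> x \<cdot> e\<close>, which is visibly
  idempotent. An idempotent is its own inverse, so \<open>e \<cdot> g = x\<close>.
\<close>

lemma idem_mult_idem:
  assumes e: "e \<in> S" "e \<cdot> e = e" and g: "g \<in> S" "g \<cdot> g = g"
  shows "(e \<cdot> g) \<cdot> (e \<cdot> g) = e \<cdot> g"
proof -
  define x where "x = inverse_of (e \<cdot> g)"
  have eg: "e \<cdot> g \<in> S" and x: "x \<in> S"
    using e g closed inverse_of_closed unfolding x_def by auto
  have x1: "e \<cdot> (g \<cdot> (x \<cdot> (e \<cdot> g))) = e \<cdot> g" and x2: "x \<cdot> (e \<cdot> (g \<cdot> x)) = x"
    using mult_inverse_mult[OF eg] inverse_mult_inverse[OF eg] e g x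
    unfolding x_def[symmetric] by (auto simp: assoc closed)
  have ee: "e \<cdot> (e \<cdot> z) = e \<cdot> z" and gg: "g \<cdot> (g \<cdot> z) = g \<cdot> z" if "z \<in> S" for z
    using that e g by (simp_all flip: assoc)
  have x2': "x \<cdot> (e \<cdot> (g \<cdot> (x \<cdot> z))) = x \<cdot> z" if "z \<in> S" for z
    using arg_cong[OF x2, of "\<lambda>y. y \<cdot> z"] that e g x by (simp add: assoc closed)
  have "inverse_of (e \<cdot> g) = g \<cdot> x \<cdot> e"
    using e g x by (intro inverse_of_eqI) (auto simp: assoc closed ee gg x1 x2')
  then have eq: "x = g \<cdot> (x \<cdot> e)"
    using e g x by (simp add: x_def assoc)
  have "(g \<cdot> (x \<cdot> e)) \<cdot> (g \<cdot> (x \<cdot> e)) = g \<cdot> (x \<cdot> e)"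
    using e g x by (simp add: assoc closed x2')
  then have xx: "x \<cdot> x = x"
    by (simp flip: eq)
  have "inverse_of x = e \<cdot> g"
    using eg x mult_inverse_mult[OF eg] inverse_mult_inverse[OF eg]
    unfolding x_def by (intro inverse_of_eqI)
  moreover have "inverse_of x = x"
    using x xx by (intro inverse_of_eqI) simp_all
  ultimately have "e \<cdot> g = x"
    by simp
  then show ?thesis
    using xx by simp
qed

lemma idem_commute:
  assumes e: "e \<in> S" "e \<cdot> e = e" and g: "g \<in> S" "g \<cdot> g = g"
  shows "e \<cdot> g = g \<cdot> e"
proof -
  have eg: "(e \<cdot> g) \<cdot> (e \<cdot> g) = e \<cdot> g" and ge: "(g \<cdot> e) \<cdot> (g \<cdot> e) = g \<cdot> e"
    using idem_mult_idem assms by auto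
  have ee: "e \<cdot> (e \<cdot> z) = e \<cdot> z" and gg: "g \<cdot> (g \<cdot> z) = g \<cdot> z" if "z \<in> S" for z
    using that e g by (simp_all flip: assoc)
  \<comment> \<open>Both \<open>g \<cdot> e\<close> and the idempotent \<open>e \<cdot> g\<close> itself are inverse to \<open>e \<cdot> g\<close>.\<close>
  have "inverse_of (e \<cdot> g) = g \<cdot> e"
    using e g eg ge by (intro inverse_of_eqI) (auto simp: assoc closed ee gg)
  moreover have "inverse_of (e \<cdot> g) = e \<cdot> g"
    using e g eg by (intro inverse_of_eqI) (auto simp: closed)
  ultimately show ?thesis
    by simp
qed

end

text \<open>
  If \<open>x\<close> and \<open>y\<close> are both inverse to \<open>a\<close>, then the idempotents \<open>x a\<close>, \<open>y a\<close> commute and so do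
  \<open>a x\<close>, \<open>a y\<close>; this rewrites both \<open>x\<close> and \<open>y\<close> to \<open>y a x\<close>. For existence, any \<open>y\<close> with
  \<open>a y a = a\<close> will do, since \<open>y a y\<close> is then an inverse.
\<close>

lemma inverse_semigroup_if_idem_commute:
  fixes f :: "'a \<Rightarrow> 'a \<Rightarrow> 'a" (infixl "\<cdot>" 70)
  assumes cl: "\<And>a b. a \<in> S \<Longrightarrow> b \<in> S \<Longrightarrow> a \<cdot> b \<in> S"
    and as: "\<And>a b c. a \<in> S \<Longrightarrow> b \<in> S \<Longrightarrow> c \<in> S \<Longrightarrow> (a \<cdot> b) \<cdot> c = a \<cdot> (b \<cdot> c)"
    and regular: "\<And>a. a \<in> S \<Longrightarrow> \<exists>y\<in>S. a \<cdot> y \<cdot> a = a"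
    and comm: "\<And>e g. e \<in> S \<Longrightarrow> g \<in> S \<Longrightarrow> e \<cdot> e = e \<Longrightarrow> g \<cdot> g = g \<Longrightarrow> e \<cdot> g = g \<cdot> e"
  shows "inverse_semigroup S f"
proof
  fix a assume a: "a \<in> S"
  obtain y where y: "y \<in> S" "a \<cdot> y \<cdot> a = a"
    using regular a by blast
  have aya: "a \<cdot> (y \<cdot> (a \<cdot> z)) = a \<cdot> z" if "z \<in> S" for z
    using y a that by (simp flip: as add: cl)
  show "\<exists>!x. x \<in> S \<and> a \<cdot> x \<cdot> a = a \<and> x \<cdot> a \<cdot> x = x"
  proof (rule ex1I)
    show "y \<cdot> a \<cdot> y \<in> S \<and> a \<cdot> (y \<cdot> a \<cdot> y) \<cdot> a = a \<and> (y \<cdot> a \<cdot> y) \<cdot> a \<cdot> (y \<cdot> a \<cdot> y) = y \<cdot> a \<cdot> y"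
      using a y aya by (simp add: as cl)
  next
    have mid: "x = z \<cdot> a \<cdot> x \<and> x = x \<cdot> a \<cdot> z"
      if x: "x \<in> S" "a \<cdot> x \<cdot> a = a" "x \<cdot> a \<cdot> x = x"
        and z: "z \<in> S" "a \<cdot> z \<cdot> a = a" for x z
    proof -
      have xaxa: "(x \<cdot> a) \<cdot> (x \<cdot> a) = x \<cdot> a" and zaza: "(z \<cdot> a) \<cdot> (z \<cdot> a) = z \<cdot> a"
        using a x z by (simp_all add: as cl)
      have axax: "(a \<cdot> x) \<cdot> (a \<cdot> x) = a \<cdot> x" and azaz: "(a \<cdot> z) \<cdot> (a \<cdot> z) = a \<cdot> z"
        using a x z by (simp_all flip: as add: cl)
      have "x = x \<cdot> (a \<cdot> z \<cdot> a) \<cdot> x"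
        using x z by simp
      also have "\<dots> = (x \<cdot> a) \<cdot> (z \<cdot> a) \<cdot> x"
        using a x z by (simp add: as cl)
      also have "(x \<cdot> a) \<cdot> (z \<cdot> a) = (z \<cdot> a) \<cdot> (x \<cdot> a)"
        using a x z xaxa zaza by (intro comm cl) auto
      also have "\<dots> \<cdot> x = z \<cdot> a \<cdot> (x \<cdot> a \<cdot> x)"
        using a x(1) z by (simp add: as cl)
      finally have 1: "x = z \<cdot> a \<cdot> x"
        using x by simp
      have "x = x \<cdot> (a \<cdot> z \<cdot> a) \<cdot> x"
        using x z by simp
      also have "\<dots> = x \<cdot> ((a \<cdot> z) \<cdot> (a \<cdot> x))"
        using a x(1) z(1) by (simp add: as cl)
      also have "(a \<cdot> z) \<cdot> (a \<cdot> x) = (a \<cdot> x) \<cdot> (a \<cdot> z)"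
        using a x z axax azaz by (intro comm cl) auto
      also have "x \<cdot> \<dots> = (x \<cdot> a \<cdot> x) \<cdot> a \<cdot> z"
        using a x(1) z(1) by (simp add: as cl)
      finally have 2: "x = x \<cdot> a \<cdot> z"
        using x by simp
      from 1 2 show ?thesis
        by blast
    qed
    fix x assume "x \<in> S \<and> a \<cdot> x \<cdot> a = a \<and> x \<cdot> a \<cdot> x = x"
    moreover have "(y \<cdot> a \<cdot> y) \<in> S" "a \<cdot> (y \<cdot> a \<cdot> y) \<cdot> a = a"
      "(y \<cdot> a \<cdot> y) \<cdot> a \<cdot> (y \<cdot> a \<cdot> y) = y \<cdot> a \<cdot> y"
      using a y aya by (simp_all add: as cl)
    ultimately show "x = y \<cdot> a \<cdot> y"
      using mid by metis
  qed
qed (use cl as in auto)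

lemma
  assumes "inverse_semigroup S f" "inverse_semigroup T g"
  defines "h \<equiv> \<lambda>(a, u) (b, v). (f a b, g u v)"
  shows inverse_semigroup_Times: "inverse_semigroup (S \<times> T) h"
    and inverse_of_Times: "a \<in> S \<Longrightarrow> u \<in> T \<Longrightarrow> inverse_semigroup.inverse_of (S \<times> T) h (a, u) =
      (inverse_semigroup.inverse_of S f a, inverse_semigroup.inverse_of T g u)"
proof -
  interpret S: inverse_semigroup S f by fact
  interpret T: inverse_semigroup T g by fact
  show *: "inverse_semigroup (S \<times> T) h"
  proof (rule inverse_semigroup_if_idem_commute)
    fix x assume "x \<in> S \<times> T"
    then obtain a u where x: "x = (a, u)" "a \<in> S" "u \<in> T"
      by auto
    then have "h (h x (S.inverse_of a, T.inverse_of u)) x = x"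
      by (simp add: h_def S.mult_inverse_mult T.mult_inverse_mult)
    then show "\<exists>y\<in>S \<times> T. h (h x y) x = x"
      using x S.inverse_of_closed T.inverse_of_closed by blast
  qed (auto simp: h_def S.closed T.closed S.assoc T.assoc S.idem_commute T.idem_commute)
  assume "a \<in> S" "u \<in> T"
  then show "inverse_semigroup.inverse_of (S \<times> T) h (a, u) = (S.inverse_of a, T.inverse_of u)"
    by (intro inverse_semigroup.inverse_of_eqI[OF *])
       (auto simp: h_def S.mult_inverse_mult T.mult_inverse_mult S.inverse_of_closed
          T.inverse_of_closed S.inverse_mult_inverse T.inverse_mult_inverse)
qed

section \<open>Actions by automorphisms\<close>

lemma AutoGroup_bij_betw:
  "\<phi> \<in> carrier (AutoGroup (semigroup_record S f)) \<Longrightarrow> bij_betw \<phi> S S"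
  by (auto simp: AutoGroup_def auto_def semigroup_record_def Bij_def)

lemma AutoGroup_mult:
  "\<phi> \<in> carrier (AutoGroup (semigroup_record S f)) \<Longrightarrow> a \<in> S \<Longrightarrow> b \<in> S \<Longrightarrow>
    \<phi> (f a b) = f (\<phi> a) (\<phi> b)"
  by (auto simp: AutoGroup_def auto_def semigroup_record_def hom_def)

context matched_product_system
begin

text \<open>
  Interchanging the two factors turns a fact about the first component into the corresponding fact
  about the second, with the prefix \<open>swap\<close>. The swapped copies of the lemmas proved in a context
  block exist only from the next block on, hence the division into blocks.
\<close>

sublocale swap: matched_product_system T plusT circT S plusS circS \<beta> \<alpha>
  by unfold_locales (use alpha_hom beta_hom alpha_circ beta_circ fixed in auto)

abbreviation alpha_inv :: "'b \<Rightarrow> 'a \<Rightarrow> 'a" where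
  "alpha_inv u \<equiv> inv_into S (\<alpha> u)"

abbreviation beta_inv :: "'a \<Rightarrow> 'b \<Rightarrow> 'b" where
  "beta_inv a \<equiv> inv_into T (\<beta> a)"

lemma alpha_Auto: "u \<in> T \<Longrightarrow> \<alpha> u \<in> carrier (AutoGroup (semigroup_record S plusS))"
  using alpha_hom by (auto simp: hom_def semigroup_record_def)

lemma alpha_closed: "u \<in> T \<Longrightarrow> a \<in> S \<Longrightarrow> \<alpha> u a \<in> S"
  using AutoGroup_bij_betw[OF alpha_Auto] bij_betwE by blast

lemma alpha_inv_closed: "u \<in> T \<Longrightarrow> a \<in> S \<Longrightarrow> alpha_inv u a \<in> S"
  using AutoGroup_bij_betw[OF alpha_Auto] bij_betwE bij_betw_inv_into by blast

lemma alpha_alpha_inv: "u \<in> T \<Longrightarrow> a \<in> S \<Longrightarrow> \<alpha> u (alpha_inv u a) = a"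
  using AutoGroup_bij_betw[OF alpha_Auto] bij_betw_inv_into_right by fast

lemma alpha_inv_alpha: "u \<in> T \<Longrightarrow> a \<in> S \<Longrightarrow> alpha_inv u (\<alpha> u a) = a"
  using AutoGroup_bij_betw[OF alpha_Auto] bij_betw_inv_into_left by fast

lemma alpha_plus: "u \<in> T \<Longrightarrow> a \<in> S \<Longrightarrow> b \<in> S \<Longrightarrow> \<alpha> u (a +\<^sub>S b) = \<alpha> u a +\<^sub>S \<alpha> u b"
  using AutoGroup_mult[OF alpha_Auto] .

lemma alpha_minus:
  "u \<in> T \<Longrightarrow> a \<in> S \<Longrightarrow> \<alpha> u (S.plus.inverse_of a) = S.plus.inverse_of (\<alpha> u a)"
  by (rule S.plus.inverse_of_eqI[symmetric])
     (simp_all add: alpha_closed S.plus.inverse_of_closed S.plus.closed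
       S.plus.mult_inverse_mult S.plus.inverse_mult_inverse flip: alpha_plus)

lemma alpha_mult:
  assumes "u \<in> T" "v \<in> T" "a \<in> S"
  shows "\<alpha> (u \<circ>\<^sub>T v) a = \<alpha> u (\<alpha> v a)"
proof -
  have Bij: "\<alpha> w \<in> Bij S" if "w \<in> T" for w
    using alpha_Auto[OF that] by (simp add: AutoGroup_def auto_def semigroup_record_def)
  have "\<alpha> (u \<circ>\<^sub>T v) = \<alpha> u \<otimes>\<^bsub>AutoGroup (semigroup_record S plusS)\<^esub> \<alpha> v"
    using alpha_hom assms by (auto simp: hom_def semigroup_record_def)
  then show ?thesis
    using assms Bij by (simp add: AutoGroup_def BijGroup_def semigroup_record_def compose_def)
qed

lemma alpha_inv_mult:
  assumes "u \<in> T" "v \<in> T" "a \<in> S"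
  shows "alpha_inv (u \<circ>\<^sub>T v) a = alpha_inv v (alpha_inv u a)"
  using assms
  by (metis T.circ.closed alpha_alpha_inv alpha_inv_alpha alpha_inv_closed alpha_mult)

text \<open>
  From \<open>\<alpha>\<^sub>e \<alpha>\<^sub>e = \<alpha>\<^sub>e\<close> one \<open>\<alpha>\<^sub>e\<close> can be cancelled, because it is injective.
\<close>

lemma alpha_idem:
  assumes "e \<in> T" "e \<circ>\<^sub>T e = e" "a \<in> S"
  shows "\<alpha> e a = a"
  using assms by (metis alpha_closed alpha_inv_alpha alpha_mult)

lemma alpha_inv_idem:
  assumes "e \<in> T" "e \<circ>\<^sub>T e = e" "a \<in> S"
  shows "alpha_inv e a = a"
  using assms by (metis alpha_idem alpha_inv_alpha)

end

section \<open>The matched product\<close>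

context matched_product_system
begin

definition mcirc :: "'a \<times> 'b \<Rightarrow> 'a \<times> 'b \<Rightarrow> 'a \<times> 'b" where
  "mcirc = (\<lambda>(a, u) (b, v). (\<alpha> u (alpha_inv u a \<circ>\<^sub>S b), \<beta> a (beta_inv a u \<circ>\<^sub>T v)))"

lemma mcirc_Pair:
  "mcirc (a, u) (b, v) = (\<alpha> u (alpha_inv u a \<circ>\<^sub>S b), \<beta> a (beta_inv a u \<circ>\<^sub>T v))"
  by (simp add: mcirc_def)

lemma mcirc_Pair':
  "a \<in> S \<Longrightarrow> u \<in> T \<Longrightarrow> b \<in> S \<Longrightarrow> v \<in> T \<Longrightarrow>
    mcirc (a, u) (b, v) = (a \<circ>\<^sub>S \<alpha> (beta_inv a u) b, u \<circ>\<^sub>T \<beta> (alpha_inv u a) v)"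
  by (simp add: mcirc_Pair alpha_circ beta_circ)

lemma fst_mcirc_closed:
  "a \<in> S \<Longrightarrow> u \<in> T \<Longrightarrow> b \<in> S \<Longrightarrow> \<alpha> u (alpha_inv u a \<circ>\<^sub>S b) \<in> S"
  by (simp add: alpha_closed alpha_inv_closed S.circ.closed)

text \<open>
  Since \<open>\<alpha>\<^sub>u\<close> is additive and sends \<open>-a'\<close> to \<open>-a\<close>, applying it to the distributive law of \<open>S\<close>
  for \<open>a' \<circ> (b + c)\<close> gives the law in the product.
\<close>

lemma fst_mcirc_distrib:
  assumes "a \<in> S" "u \<in> T" "b \<in> S" "c \<in> S"
  shows "\<alpha> u (alpha_inv u a \<circ>\<^sub>S (b +\<^sub>S c)) =
    \<alpha> u (alpha_inv u a \<circ>\<^sub>S b) +\<^sub>S S.plus.inverse_of a +\<^sub>S \<alpha> u (alpha_inv u a \<circ>\<^sub>S c)"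
  using assms by (simp add: S.distrib alpha_plus alpha_minus alpha_alpha_inv alpha_inv_closed
      S.plus.closed S.circ.closed S.plus.inverse_of_closed)

end

context matched_product_system
begin

lemma mcirc_closed: "x \<in> S \<times> T \<Longrightarrow> y \<in> S \<times> T \<Longrightarrow> mcirc x y \<in> S \<times> T"
  by (auto simp: mcirc_Pair fst_mcirc_closed swap.fst_mcirc_closed)

text \<open>
  Written in its second form, the left side is \<open>A \<circ> \<alpha>\<^sub>X(c)\<close>. With \<open>A\<close> in its second form and
  \<open>U\<close> in its first, \<open>A = a \<circ> d\<close> and the index becomes \<open>X = \<beta>\<^sub>d\<^sup>-\<^sup>1(u' \<circ> v)\<close>, where
  \<open>d = \<alpha>\<^sub>u\<^sub>'(b)\<close>. The compatibility condition, applied to \<open>d\<close> and \<open>u' \<circ> v\<close>, turns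
  \<open>d \<circ> \<alpha>\<^sub>X(c)\<close> into \<open>\<alpha>\<^sub>u\<^sub>'(\<alpha>\<^sub>v(\<alpha>\<^sub>v\<^sup>-\<^sup>1(b) \<circ> c))\<close>, and \<open>a\<close> composed with this is the second form
  of the right side.
\<close>

lemma fst_mcirc_assoc:
  assumes a: "a \<in> S" "b \<in> S" "c \<in> S" and u: "u \<in> T" "v \<in> T"
  defines "A \<equiv> \<alpha> u (alpha_inv u a \<circ>\<^sub>S b)" and "U \<equiv> \<beta> a (beta_inv a u \<circ>\<^sub>T v)"
  shows "\<alpha> U (alpha_inv U A \<circ>\<^sub>S c) = \<alpha> u (alpha_inv u a \<circ>\<^sub>S \<alpha> v (alpha_inv v b \<circ>\<^sub>S c))"
proof -
  define u' where "u' = beta_inv a u"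
  define d where "d = \<alpha> u' b"
  define X where "X = beta_inv d (u' \<circ>\<^sub>T v)"
  have u': "u' \<in> T" "u' \<circ>\<^sub>T v \<in> T"
    using a u by (simp_all add: u'_def swap.alpha_inv_closed T.circ.closed)
  have d: "d \<in> S"
    using a u' by (simp add: d_def alpha_closed)
  have X: "X \<in> T"
    using d u' by (simp add: X_def swap.alpha_inv_closed)
  have AU: "A \<in> S" "U \<in> T"
    using a u by (simp_all add: A_def U_def fst_mcirc_closed swap.fst_mcirc_closed)
  have A_eq: "A = a \<circ>\<^sub>S d"
    using a u by (simp add: A_def d_def u'_def alpha_circ)
  have "beta_inv A U = X"
    using a u u' d
    by (simp add: A_eq U_def X_def swap.alpha_inv_mult swap.alpha_inv_alpha swap.alpha_closed
        flip: u'_def)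
  then have "\<alpha> U (alpha_inv U A \<circ>\<^sub>S c) = A \<circ>\<^sub>S \<alpha> X c"
    using AU a by (simp add: alpha_circ)
  also have "\<dots> = a \<circ>\<^sub>S (d \<circ>\<^sub>S \<alpha> X c)"
    using a d X by (simp add: A_eq S.circ.assoc alpha_closed)
  also have "d \<circ>\<^sub>S \<alpha> X c = \<alpha> (u' \<circ>\<^sub>T v) (alpha_inv (u' \<circ>\<^sub>T v) d \<circ>\<^sub>S c)"
    using d u' a by (simp add: X_def alpha_circ)
  also have "alpha_inv (u' \<circ>\<^sub>T v) d = alpha_inv v b"
    using d u' a u by (simp add: alpha_inv_mult d_def alpha_inv_alpha)
  also have "\<alpha> (u' \<circ>\<^sub>T v) (alpha_inv v b \<circ>\<^sub>S c) = \<alpha> u' (\<alpha> v (alpha_inv v b \<circ>\<^sub>S c))"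
    using u' a u by (simp add: alpha_mult alpha_inv_closed S.circ.closed)
  also have "a \<circ>\<^sub>S \<alpha> u' (\<alpha> v (alpha_inv v b \<circ>\<^sub>S c)) =
      \<alpha> u (alpha_inv u a \<circ>\<^sub>S \<alpha> v (alpha_inv v b \<circ>\<^sub>S c))"
    unfolding u'_def using a u by (intro alpha_circ[symmetric] fst_mcirc_closed)
  finally show ?thesis .
qed

end

context matched_product_system
begin

lemma mcirc_assoc:
  assumes "x \<in> S \<times> T" "y \<in> S \<times> T" "z \<in> S \<times> T"
  shows "mcirc (mcirc x y) z = mcirc x (mcirc y z)"
  using assms by (auto simp: mcirc_Pair fst_mcirc_assoc swap.fst_mcirc_assoc)

lemma mcirc_idem_pair_left:
  assumes "e \<in> S" "e \<circ>\<^sub>S e = e" "f \<in> T" "f \<circ>\<^sub>T f = f" "b \<in> S" "v \<in> T"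
  shows "mcirc (e, f) (b, v) = (e \<circ>\<^sub>S b, f \<circ>\<^sub>T v)"
  using assms by (simp add: mcirc_Pair alpha_idem alpha_inv_idem swap.alpha_idem
      swap.alpha_inv_idem S.circ.closed T.circ.closed)

text \<open>
  The element \<open>y\<close> is chosen so that \<open>\<alpha>\<^sub>u\<^sub>'\<close> and \<open>\<beta>\<^sub>a\<^sub>'\<close> cancel in the second form of the product.
\<close>

lemma mcirc_weak_inverse:
  assumes "a \<in> S" "u \<in> T"
  obtains y where "y \<in> S \<times> T"
    "mcirc (a, u) y = (a \<circ>\<^sub>S S.circ.inverse_of a, u \<circ>\<^sub>T T.circ.inverse_of u)"
    "mcirc (mcirc (a, u) y) (a, u) = (a, u)"
proof
  let ?y = "(alpha_inv (beta_inv a u) (S.circ.inverse_of a),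
             beta_inv (alpha_inv u a) (T.circ.inverse_of u))"
  note inv = S.circ.inverse_of_closed T.circ.inverse_of_closed
    alpha_inv_closed swap.alpha_inv_closed
  show "?y \<in> S \<times> T"
    using assms by (simp add: inv)
  show xy: "mcirc (a, u) ?y = (a \<circ>\<^sub>S S.circ.inverse_of a, u \<circ>\<^sub>T T.circ.inverse_of u)"
    using assms by (simp add: mcirc_Pair' inv alpha_alpha_inv swap.alpha_alpha_inv)
  show "mcirc (mcirc (a, u) ?y) (a, u) = (a, u)"
    unfolding xy using assms
    by (simp add: mcirc_idem_pair_left inv S.circ.closed T.circ.closed S.circ.mult_inverse_idem
        T.circ.mult_inverse_idem S.circ.mult_inverse_mult T.circ.mult_inverse_mult)
qed

text \<open>
  Idempotency of \<open>(a, u)\<close> is literally the premise of the last condition on a matched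
  product system. That condition gives \<open>\<alpha>\<^sub>u(a) = a\<close>, so idempotency reads
  \<open>\<alpha>\<^sub>u(a \<circ> a) = \<alpha>\<^sub>u(a)\<close>.
\<close>

lemma mcirc_idemD:
  assumes "a \<in> S" "u \<in> T" "mcirc (a, u) (a, u) = (a, u)"
  shows "a \<circ>\<^sub>S a = a" "u \<circ>\<^sub>T u = u"
proof -
  have idem: "\<alpha> u (alpha_inv u a \<circ>\<^sub>S a) = a" "\<beta> a (beta_inv a u \<circ>\<^sub>T u) = u"
    using assms by (simp_all add: mcirc_Pair)
  then have fix_a: "\<alpha> u a = a" and fix_u: "\<beta> a u = u"
    using fixed assms by blast+
  have "alpha_inv u a = a" "beta_inv a u = u"
    using alpha_inv_alpha[of u a] swap.alpha_inv_alpha[of a u] fix_a fix_u assms by simp_all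
  then have "\<alpha> u (a \<circ>\<^sub>S a) = \<alpha> u a" "\<beta> a (u \<circ>\<^sub>T u) = \<beta> a u"
    using idem fix_a fix_u by simp_all
  then show "a \<circ>\<^sub>S a = a" "u \<circ>\<^sub>T u = u"
    using assms by (metis alpha_inv_alpha S.circ.closed, metis swap.alpha_inv_alpha T.circ.closed)
qed

lemma inverse_semigroup_mcirc: "inverse_semigroup (S \<times> T) mcirc"
proof (rule inverse_semigroup_if_idem_commute)
  show "\<exists>y\<in>S \<times> T. mcirc (mcirc x y) x = x" if "x \<in> S \<times> T" for x
    using that mcirc_weak_inverse by (metis SigmaE)
next
  fix x y assume xy: "x \<in> S \<times> T" "y \<in> S \<times> T" "mcirc x x = x" "mcirc y y = y"
  obtain e f g h where eq: "x = (e, f)" "y = (g, h)"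
    by (cases x, cases y)
  have mem: "e \<in> S" "f \<in> T" "g \<in> S" "h \<in> T"
    and "e \<circ>\<^sub>S e = e" "f \<circ>\<^sub>T f = f" "g \<circ>\<^sub>S g = g" "h \<circ>\<^sub>T h = h"
    using xy mcirc_idemD unfolding eq by auto
  then show "mcirc x y = mcirc y x"
    unfolding eq by (simp add: mcirc_idem_pair_left S.circ.idem_commute T.circ.idem_commute)
qed (auto simp: mcirc_closed mcirc_assoc)

text \<open>
  If \<open>x y x = x\<close> then \<open>y x y\<close> is the inverse of \<open>x\<close>, and \<open>x (y x y) = x y\<close>; the
  weak inverse of \<open>x\<close> constructed above therefore already determines \<open>x x\<^sup>-\<close>.
\<close>

lemma mcirc_inverse:
  assumes "a \<in> S" "u \<in> T"
  shows "mcirc (a, u) (inverse_semigroup.inverse_of (S \<times> T) mcirc (a, u)) =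
    (a \<circ>\<^sub>S S.circ.inverse_of a, u \<circ>\<^sub>T T.circ.inverse_of u)"
proof -
  interpret M: inverse_semigroup "S \<times> T" mcirc
    by (rule inverse_semigroup_mcirc)
  obtain y where y: "y \<in> S \<times> T"
    "mcirc (a, u) y = (a \<circ>\<^sub>S S.circ.inverse_of a, u \<circ>\<^sub>T T.circ.inverse_of u)"
    "mcirc (mcirc (a, u) y) (a, u) = (a, u)"
    using mcirc_weak_inverse assms by metis
  have x: "(a, u) \<in> S \<times> T"
    using assms by simp
  have "M.inverse_of (a, u) = mcirc (mcirc y (a, u)) y"
    using x y(1,3) by (intro M.inverse_of_eqI) (metis M.assoc M.closed)+
  then show ?thesis
    using x y M.assoc M.closed by metis
qed

lemma weak_brace_matched_product:
  "weak_brace (S \<times> T) (\<lambda>(a, u) (b, v). (a +\<^sub>S b, u +\<^sub>T v)) mcirc"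
proof -
  interpret P: inverse_semigroup "S \<times> T" "\<lambda>(a, u) (b, v). (a +\<^sub>S b, u +\<^sub>T v)"
    by (intro inverse_semigroup_Times S.plus.inverse_semigroup_axioms
        T.plus.inverse_semigroup_axioms)
  interpret M: inverse_semigroup "S \<times> T" mcirc
    by (rule inverse_semigroup_mcirc)
  note minus = inverse_of_Times[OF S.plus.inverse_semigroup_axioms
      T.plus.inverse_semigroup_axioms]
  show ?thesis
  proof unfold_locales
    show "S \<times> T \<noteq> {}"
      using S.nonempty T.nonempty by auto
  qed (auto simp: minus mcirc_Pair fst_mcirc_distrib swap.fst_mcirc_distrib mcirc_inverse
      S.circ_inverse T.circ_inverse)
qed

end

section \<open>The matched product is a weak brace\<close>

theorem theorem22:
  fixes S :: "'a set" and T :: "'b set"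
    and plusS circS :: "'a \<Rightarrow> 'a \<Rightarrow> 'a" and plusT circT :: "'b \<Rightarrow> 'b \<Rightarrow> 'b"
    and \<alpha> :: "'b \<Rightarrow> 'a \<Rightarrow> 'a" and \<beta> :: "'a \<Rightarrow> 'b \<Rightarrow> 'b"
  assumes "matched_product_system S plusS circS T plusT circT \<alpha> \<beta>"
  shows "weak_brace (S \<times> T)
    (\<lambda>(a, u) (b, v). (plusS a b, plusT u v))
    (\<lambda>(a, u) (b, v). (\<alpha> u (circS (inv_into S (\<alpha> u) a) b), \<beta> a (circT (inv_into T (\<beta> a) u) v)))"
  using matched_product_system.weak_brace_matched_product[OF assms]
  unfolding matched_product_system.mcirc_def[OF assms] .

end
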